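(* Let $\mathbb{X}$ be a finite subset of the projective space $\mathbb{P}^{s-1}$ over a field $K$ and let $I(\mathbb{X})\subset S=K[t_1,\ldots,t_s]$ be its vanishing ideal. If $F=\{f_1,\ldots,f_r\}$ is a set of homogeneous polynomials of $S\setminus\{0\}$, then the number of points of $V_\mathbb{X}(F)$ is given by $$ |V_{\mathbb{X}}(F)|=\left\{ \begin{array}{cl} \deg(S/(I(\mathbb{X}),F))&\mbox{if }(I(\mathbb{X})\colon(F))\neq I(\mathbb{X}),\\ 0&\mbox{if }(I(\mathbb{X})\colon(F))=I(\mathbb{X}). \end{array}\right. $$
   Context: $S=K[t_1,\ldots,t_s]=\bigoplus_{d\ge0} S_d$ has the standard grading; $r\geq 1$. $I(\mathbb{X})$ is the ideal generated by the homogeneous polynomials vanishing at all points of $\mathbb{X}$; $V_\mathbb{X}(F)$ is the set of $[\alpha]\in\mathbb{X}$ with $f(\alpha)=0$ for all $f\in F$; $(I\colon(F))=\{g\in S : gf\in I\ \forall f\in F\}$; $(I,F)$ is the ideal generated by $I$ and $F$. For a graded ideal $I$ with Hilbert function $H_I(d)=\dim_K(S_d/(I\cap S_d))$ and $k=\dim(S/I)$ the Krull dimension, $\deg(S/I)=(k-1)!\lim_{d\to\infty}H_I(d)/d^{k-1}$ if $k\geq 1$, and $\deg(S/I)=\dim_K(S/I)$ if $k=0$. *)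

theory Defs
  imports
    "HOL-Analysis.Analysis"
    "HOL-Algebra.QuotRing"
    "HOL-Algebra.Algebraic_Closure_Type"
    "HOL-Library.Poly_Mapping"
    "HOL-Library.Extended_Nat"
begin

unbundle no fps_syntax

section \<open>Polynomials and their grading\<close>

text \<open>The polynomial ring in finitely many variables \<open>t\<^sub>i\<close>, indexed by \<open>'n\<close>: a polynomial
  is a finitely supported map from exponent vectors to coefficients.  The number of variables
  is \<open>CARD('n)\<close>, which is at least 1.\<close>

type_synonym ('n, 'k) mvpoly = "('n \<Rightarrow>\<^sub>0 nat) \<Rightarrow>\<^sub>0 'k"

abbreviation (input) mvpoly_ring :: "('n::finite, 'k::field) mvpoly ring" where
  "mvpoly_ring \<equiv> ring_of_type_algebra"

definition const :: "'k::field \<Rightarrow> ('n::finite, 'k) mvpoly" where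
  "const c = Poly_Mapping.single 0 c"

definition eval :: "('n::finite, 'k::field) mvpoly \<Rightarrow> 'k ^ 'n \<Rightarrow> 'k" where
  "eval f \<alpha> = (\<Sum>m\<in>Poly_Mapping.keys f. Poly_Mapping.lookup f m * (\<Prod>i\<in>UNIV. (\<alpha> $ i) ^ Poly_Mapping.lookup m i))"

definition graded_part :: "nat \<Rightarrow> ('n::finite, 'k::field) mvpoly set" where
  "graded_part d = {f. \<forall>m\<in>Poly_Mapping.keys f. (\<Sum>i\<in>UNIV. Poly_Mapping.lookup m i) = d}"

definition homogeneous :: "('n::finite, 'k::field) mvpoly \<Rightarrow> bool" where
  "homogeneous f \<longleftrightarrow> (\<exists>d. f \<in> graded_part d)"

section \<open>Projective points and vanishing\<close>

definition proportional :: "(('k::field ^ 'n::finite) \<times> ('k ^ 'n)) set" where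
  "proportional = {(\<alpha>, \<beta>). \<alpha> \<noteq> 0 \<and> \<beta> \<noteq> 0 \<and> (\<exists>c. c \<noteq> 0 \<and> \<beta> = c *s \<alpha>)}"

text \<open>A point of the projective space is the set of all its representatives.\<close>

definition proj_space :: "('k::field ^ 'n::finite) set set" where
  "proj_space = (UNIV - {0}) // proportional"

text \<open>For homogeneous \<open>f\<close>, vanishing does not depend on the chosen representative.\<close>

definition vanishes_at :: "('n::finite, 'k::field) mvpoly \<Rightarrow> ('k ^ 'n) set \<Rightarrow> bool" where
  "vanishes_at f p \<longleftrightarrow> (\<forall>\<alpha>\<in>p. eval f \<alpha> = 0)"

definition vanishing_ideal :: "('k::field ^ 'n::finite) set set \<Rightarrow> ('n, 'k) mvpoly set" where
  "vanishing_ideal \<X> = Idl\<^bsub>mvpoly_ring\<^esub> {f. homogeneous f \<and> (\<forall>p\<in>\<X>. vanishes_at f p)}"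

definition zero_locus ::
    "('k::field ^ 'n::finite) set set \<Rightarrow> ('n, 'k) mvpoly set \<Rightarrow> ('k ^ 'n) set set" where
  "zero_locus \<X> F = {p \<in> \<X>. \<forall>f\<in>F. vanishes_at f p}"

definition colon ::
    "('n::finite, 'k::field) mvpoly set \<Rightarrow> ('n, 'k) mvpoly set \<Rightarrow> ('n, 'k) mvpoly set" where
  "colon I F = {g. \<forall>f\<in>F. g * f \<in> I}"

section \<open>Hilbert function, Krull dimension and degree\<close>

text \<open>\<open>quot_basis V W B\<close>: the classes of the elements of \<open>B \<subseteq> V\<close> are pairwise distinct and form
  a \<open>K\<close>-basis of the quotient space \<open>V / W\<close>; here \<open>W \<subseteq> V\<close> are \<open>K\<close>-subspaces.\<close>

definition quot_basis ::
    "('n::finite, 'k::field) mvpoly set \<Rightarrow> ('n, 'k) mvpoly set \<Rightarrow> ('n, 'k) mvpoly set \<Rightarrow> bool" where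
  "quot_basis V W B \<longleftrightarrow>
     B \<subseteq> V \<and>
     (\<forall>A c. finite A \<and> A \<subseteq> B \<and> (\<Sum>b\<in>A. const (c b) * b) \<in> W \<longrightarrow> (\<forall>b\<in>A. c b = 0)) \<and>
     (\<forall>v\<in>V. \<exists>A c. finite A \<and> A \<subseteq> B \<and> v - (\<Sum>b\<in>A. const (c b) * b) \<in> W)"

text \<open>The dimension of \<open>V / W\<close>; as usual for \<^const>\<open>card\<close>, it is 0 if \<open>V / W\<close> is
  infinite-dimensional.\<close>

definition quot_dim ::
    "('n::finite, 'k::field) mvpoly set \<Rightarrow> ('n, 'k) mvpoly set \<Rightarrow> nat" where
  "quot_dim V W = card (SOME B. quot_basis V W B)"

definition hilbert_fun :: "('n::finite, 'k::field) mvpoly set \<Rightarrow> nat \<Rightarrow> nat" where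
  "hilbert_fun I d = quot_dim (graded_part d) (I \<inter> graded_part d)"

text \<open>The supremum of the lengths of chains of prime ideals.  The zero ring has no prime ideals
  and gets the value 0 here.\<close>

definition krull_dim :: "('a, 'b) ring_scheme \<Rightarrow> enat" where
  "krull_dim R = Sup {enat n | n. \<exists>P :: nat \<Rightarrow> 'a set.
     (\<forall>i\<le>n. primeideal (P i) R) \<and> (\<forall>i<n. P i \<subset> P (Suc i))}"

text \<open>\<open>quot_degree I\<close> is the degree of \<open>S / I\<close>, for a graded ideal \<open>I\<close> of the polynomial ring
  \<open>S\<close>.  The Krull dimension of \<open>S / I\<close> is finite, so \<^const>\<open>the_enat\<close> loses nothing.  For \<open>I = S\<close>
  the value is \<open>dim\<^sub>K (S / S) = 0\<close>.\<close>

definition quot_degree :: "('n::finite, 'k::field) mvpoly set \<Rightarrow> real" where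
  "quot_degree I =
     (let k = the_enat (krull_dim (mvpoly_ring Quot I)) in
      if k \<ge> 1 then fact (k - 1) * lim (\<lambda>d. real (hilbert_fun I d) / real d ^ (k - 1))
      else real (quot_dim UNIV I))"

end

theory Submission
  imports Defs
begin

text \<open>
  Write \<open>I\<close> for the vanishing ideal of \<open>\<X>\<close>, and \<open>V\<close> for the zero locus of \<open>F\<close> in
  \<open>\<X>\<close>. All of the argument is driven by restricting polynomials to lines: for a vector
  \<open>\<alpha> \<noteq> 0\<close>, the map \<open>f \<mapsto> f(\<alpha> x)\<close> is a surjective homomorphism from \<open>S\<close> to the principal ideal
  domain \<open>K[x]\<close>, its kernel is the prime ideal of the point \<open>[\<alpha>]\<close>, and \<open>I\<close> is the intersection
  of these kernels over the points of \<open>\<X>\<close> (\<open>vanishing_ideal_eq\<close>).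

  The points of \<open>\<X>\<close> can be separated by forms of any degree \<open>d \<ge> |\<X>|\<close>: there are forms
  \<open>e\<^sub>p\<close> of degree \<open>d\<close> with value 1 at \<open>p\<close> and 0 at the other points (\<open>exists_dual_forms\<close>). They
  explain both cases of the formula.

  The case distinction says whether \<open>V\<close> is empty (\<open>colon_points_eq_iff\<close>). If \<open>p \<in> V\<close>, then
  \<open>e\<^sub>p\<close> lies in \<open>(I : F)\<close> but not in \<open>I\<close>; if \<open>V\<close> is empty, no prime ideal of a point of \<open>\<X>\<close>
  contains \<open>F\<close>, and multiplying by \<open>F\<close> detects membership in each of them.

  Suppose now that \<open>V\<close> is not empty. A form of large degree is, modulo \<open>I\<close>, the combination of the
  \<open>e\<^sub>p\<close> whose coefficients are its values, and for \<open>p \<notin> V\<close> the form \<open>e\<^sub>p\<close> is congruent modulo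
  \<open>I\<close> to a multiple of an element of \<open>F\<close> that does not vanish at \<open>p\<close>. Therefore \<open>(I, F)\<close> agrees
  with the ideal of \<open>V\<close> in all large degrees (\<open>genideal_points_eventually_eq\<close>), and there the forms
  \<open>e\<^sub>p\<close> with \<open>p \<in> V\<close> are a basis of the quotient (\<open>hilbert_fun_points\<close>). So the Hilbert function
  of \<open>(I, F)\<close> is eventually \<open>|V|\<close>. This is the degree as soon as the Krull dimension is 1
  (\<open>krull_dim_points\<close>): a prime ideal containing \<open>I\<close> contains the prime ideal of some point, so
  chains of primes above it are chains in \<open>K[x]\<close>, where nonzero primes are maximal.
\<close>

section \<open>Restriction of a polynomial to a line through the origin\<close>

text \<open>The polynomial \<open>f(\<alpha>\<^sub>1 x, \<dots>, \<alpha>\<^sub>n x)\<close> in one variable \<open>x\<close>. Over a finite field the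
values of \<open>f\<close> on the line spanned by \<open>\<alpha>\<close> do not determine its restriction, which is
why this is a polynomial and not a function. Its coefficient of \<open>x\<^sup>d\<close> is the value at \<open>\<alpha>\<close> of the degree
\<open>d\<close> part of \<open>f\<close>, so it sees all homogeneous components of \<open>f\<close> at once.\<close>

definition line_restriction :: "'k::field ^ 'n::finite \<Rightarrow> ('n, 'k) mvpoly \<Rightarrow> 'k poly" where
  "line_restriction \<alpha> f =
     (\<Sum>m\<in>Poly_Mapping.keys f. Polynomial.monom
        (Poly_Mapping.lookup f m * (\<Prod>i\<in>UNIV. (\<alpha> $ i) ^ Poly_Mapping.lookup m i))
        (\<Sum>i\<in>UNIV. Poly_Mapping.lookup m i))"

lemma line_restriction_superset:
  assumes "finite M" "Poly_Mapping.keys f \<subseteq> M"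
  shows "line_restriction \<alpha> f =
     (\<Sum>m\<in>M. Polynomial.monom
        (Poly_Mapping.lookup f m * (\<Prod>i\<in>UNIV. (\<alpha> $ i) ^ Poly_Mapping.lookup m i))
        (\<Sum>i\<in>UNIV. Poly_Mapping.lookup m i))"
  unfolding line_restriction_def
  by (rule sum.mono_neutral_left) (use assms in \<open>auto simp: in_keys_iff\<close>)

lemma line_restriction_zero [simp]: "line_restriction \<alpha> 0 = 0"
  by (simp add: line_restriction_def)

lemma line_restriction_add [simp]:
  "line_restriction \<alpha> (f + g) = line_restriction \<alpha> f + line_restriction \<alpha> g"
proof -
  let ?M = "Poly_Mapping.keys f \<union> Poly_Mapping.keys g"
  have "Poly_Mapping.keys (f + g) \<subseteq> ?M" by (rule keys_add)
  then show ?thesis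
    by (simp add: line_restriction_superset[of ?M] lookup_add distrib_right
        add_monom[symmetric] sum.distrib)
qed

lemma line_restriction_sum [simp]:
  "line_restriction \<alpha> (sum g A) = (\<Sum>x\<in>A. line_restriction \<alpha> (g x))"
  by (induction A rule: infinite_finite_induct) auto

lemma line_restriction_single:
  "line_restriction \<alpha> (Poly_Mapping.single m c) =
     Polynomial.monom (c * (\<Prod>i\<in>UNIV. (\<alpha> $ i) ^ Poly_Mapping.lookup m i))
       (\<Sum>i\<in>UNIV. Poly_Mapping.lookup m i)"
  by (cases "c = 0") (auto simp: line_restriction_def)

lemma line_restriction_const [simp]: "line_restriction \<alpha> (const c) = [:c:]"
  by (simp add: const_def line_restriction_single monom_0)

lemma line_restriction_one [simp]: "line_restriction \<alpha> 1 = 1"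
  using line_restriction_const[of \<alpha> 1] by (simp add: const_def one_pCons)

lemma sum_monomials:
  fixes f :: "'a \<Rightarrow>\<^sub>0 'b::comm_monoid_add"
  shows "(\<Sum>m\<in>Poly_Mapping.keys f. Poly_Mapping.single m (Poly_Mapping.lookup f m)) = f"
  by (rule poly_mapping_eqI)
    (auto simp: lookup_sum lookup_single when_def in_keys_iff)

lemma line_restriction_mult [simp]:
  "line_restriction \<alpha> (f * g) = line_restriction \<alpha> f * line_restriction \<alpha> g"
proof -
  let ?s = "\<lambda>h m. Poly_Mapping.single m (Poly_Mapping.lookup h m)"
  have *: "line_restriction \<alpha> (?s f m * ?s g m') =
      line_restriction \<alpha> (?s f m) * line_restriction \<alpha> (?s g m')" for m m'
    by (simp add: mult_single line_restriction_single mult_monom lookup_add power_add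
        prod.distrib sum.distrib ac_simps)
  have "line_restriction \<alpha> (sum (?s f) (Poly_Mapping.keys f) * sum (?s g) (Poly_Mapping.keys g)) =
      line_restriction \<alpha> (sum (?s f) (Poly_Mapping.keys f)) *
      line_restriction \<alpha> (sum (?s g) (Poly_Mapping.keys g))"
    unfolding sum_product line_restriction_sum * ..
  then show ?thesis by (simp only: sum_monomials)
qed

lemma line_restriction_uminus [simp]: "line_restriction \<alpha> (- f) = - line_restriction \<alpha> f"
  by (metis add.right_inverse add_eq_0_iff line_restriction_add line_restriction_zero)

lemma line_restriction_diff [simp]:
  "line_restriction \<alpha> (f - g) = line_restriction \<alpha> f - line_restriction \<alpha> g"
  by (metis diff_conv_add_uminus line_restriction_add line_restriction_uminus)

lemma line_restriction_prod [simp]: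
  "line_restriction \<alpha> (prod g A) = (\<Prod>x\<in>A. line_restriction \<alpha> (g x))"
  by (induction A rule: infinite_finite_induct) auto

text \<open>Evaluation at \<open>\<alpha>\<close> is restriction to the line followed by
\<open>x = 1\<close>; it therefore inherits its ring laws from those of the restriction.\<close>

lemma eval_eq_poly: "eval f \<alpha> = poly (line_restriction \<alpha> f) 1"
  by (simp add: eval_def line_restriction_def poly_sum poly_monom)

lemma eval_simps [simp]:
  "eval 0 \<alpha> = 0" "eval 1 \<alpha> = 1" "eval (const c) \<alpha> = c"
  "eval (f + g) \<alpha> = eval f \<alpha> + eval g \<alpha>" "eval (f - g) \<alpha> = eval f \<alpha> - eval g \<alpha>"
  "eval (f * g) \<alpha> = eval f \<alpha> * eval g \<alpha>" "eval (f ^ n) \<alpha> = eval f \<alpha> ^ n"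
  "eval (sum h A) \<alpha> = (\<Sum>x\<in>A. eval (h x) \<alpha>)" "eval (prod h A) \<alpha> = (\<Prod>x\<in>A. eval (h x) \<alpha>)"
  subgoal by (simp add: eval_eq_poly)
  subgoal by (simp add: eval_eq_poly)
  subgoal by (simp add: eval_eq_poly)
  subgoal by (simp add: eval_eq_poly)
  subgoal by (simp add: eval_eq_poly)
  subgoal by (simp add: eval_eq_poly)
  subgoal by (induction n) (simp_all add: eval_eq_poly)
  subgoal by (simp add: eval_eq_poly poly_sum)
  subgoal by (simp add: eval_eq_poly poly_prod)
  done

lemma line_restriction_graded:
  assumes "f \<in> graded_part d"
  shows "line_restriction \<alpha> f = Polynomial.monom (eval f \<alpha>) d"
proof -
  have "line_restriction \<alpha> f = (\<Sum>m\<in>Poly_Mapping.keys f. Polynomial.monom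
        (Poly_Mapping.lookup f m * (\<Prod>i\<in>UNIV. (\<alpha> $ i) ^ Poly_Mapping.lookup m i)) d)"
    unfolding line_restriction_def
    by (rule sum.cong) (use assms in \<open>auto simp: graded_part_def\<close>)
  then show ?thesis by (simp add: eval_def monom_sum)
qed

lemma line_restriction_homogeneous_eq_0_iff:
  "homogeneous f \<Longrightarrow> line_restriction \<alpha> f = 0 \<longleftrightarrow> eval f \<alpha> = 0"
  by (auto simp: homogeneous_def line_restriction_graded monom_eq_0_iff)

lemma coeff_line_restriction_scale:
  "Polynomial.coeff (line_restriction (c *s \<alpha>) f) d = c ^ d * Polynomial.coeff (line_restriction \<alpha> f) d"
  unfolding line_restriction_def coeff_sum sum_distrib_left
  by (rule sum.cong)
    (auto simp: power_mult_distrib prod.distrib power_sum)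

lemma line_restriction_scale_eq_0_iff:
  assumes "c \<noteq> 0"
  shows "line_restriction (c *s \<alpha>) f = 0 \<longleftrightarrow> line_restriction \<alpha> f = 0"
  using assms by (simp add: poly_eq_iff coeff_line_restriction_scale)

section \<open>Homogeneous components\<close>

lemma graded_part_0 [simp]: "0 \<in> graded_part d"
  by (simp add: graded_part_def)

lemma graded_part_add: "f \<in> graded_part d \<Longrightarrow> g \<in> graded_part d \<Longrightarrow> f + g \<in> graded_part d"
  using keys_add[of f g] by (auto simp: graded_part_def)

lemma graded_part_mult:
  assumes "f \<in> graded_part d" "g \<in> graded_part e"
  shows "f * g \<in> graded_part (d + e)"
  using assms keys_mult[of f g] by (fastforce simp: graded_part_def lookup_add sum.distrib)

lemma const_graded: "const c \<in> graded_part 0"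
  by (auto simp: graded_part_def const_def)

lemma graded_part_const_mult: "f \<in> graded_part d \<Longrightarrow> const c * f \<in> graded_part d"
  using graded_part_mult[OF const_graded] by fastforce

lemma graded_part_diff: "f \<in> graded_part d \<Longrightarrow> g \<in> graded_part d \<Longrightarrow> f - g \<in> graded_part d"
  using keys_diff[of f g] unfolding graded_part_def by blast

lemma graded_part_sum: "(\<And>x. x \<in> A \<Longrightarrow> h x \<in> graded_part d) \<Longrightarrow> sum h A \<in> graded_part d"
  by (induction A rule: infinite_finite_induct) (auto intro: graded_part_add)

lemma graded_part_power: "f \<in> graded_part d \<Longrightarrow> f ^ n \<in> graded_part (n * d)"
proof (induction n)
  case 0
  show ?case using const_graded[of 1] by (simp add: const_def)
qed (auto intro: graded_part_mult)

lemma graded_part_prod: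
  "(\<And>x. x \<in> A \<Longrightarrow> h x \<in> graded_part d) \<Longrightarrow> finite A \<Longrightarrow> prod h A \<in> graded_part (card A * d)"
proof (induction A rule: infinite_finite_induct)
  case empty
  show ?case using const_graded[of 1] by (simp add: const_def)
qed (auto intro: graded_part_mult)

definition homogeneous_component :: "nat \<Rightarrow> ('n::finite, 'k::field) mvpoly \<Rightarrow> ('n, 'k) mvpoly" where
  "homogeneous_component d f =
     (\<Sum>m | m \<in> Poly_Mapping.keys f \<and> (\<Sum>i\<in>UNIV. Poly_Mapping.lookup m i) = d.
        Poly_Mapping.single m (Poly_Mapping.lookup f m))"

lemma homogeneous_component_graded: "homogeneous_component d f \<in> graded_part d"
  unfolding homogeneous_component_def
  by (rule graded_part_sum) (auto simp: graded_part_def)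

lemma sum_homogeneous_components:
  "(\<Sum>d\<in>(\<lambda>m. \<Sum>i\<in>UNIV. Poly_Mapping.lookup m i) ` Poly_Mapping.keys f. homogeneous_component d f) = f"
proof -
  have "(\<Sum>d\<in>(\<lambda>m. \<Sum>i\<in>UNIV. Poly_Mapping.lookup m i) ` Poly_Mapping.keys f. homogeneous_component d f)
      = (\<Sum>m\<in>Poly_Mapping.keys f. Poly_Mapping.single m (Poly_Mapping.lookup f m))"
    unfolding homogeneous_component_def by (rule sum.image_gen[symmetric]) simp
  then show ?thesis by (simp only: sum_monomials)
qed

lemma eval_homogeneous_component:
  "eval (homogeneous_component d f) \<alpha> = Polynomial.coeff (line_restriction \<alpha> f) d"
  unfolding homogeneous_component_def line_restriction_def coeff_sum eval_simps
  by (simp add: sum.inter_filter[symmetric] eval_eq_poly line_restriction_single poly_monom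
      if_distrib if_distribR cong: if_cong)

section \<open>Ideals of a commutative ring that is a type\<close>

lemma ring_of_type_algebra_simps [simp]:
  "carrier ring_of_type_algebra = UNIV"
  "x \<otimes>\<^bsub>ring_of_type_algebra\<^esub> y = x * y" "\<one>\<^bsub>ring_of_type_algebra\<^esub> = 1"
  "x \<oplus>\<^bsub>ring_of_type_algebra\<^esub> y = x + y" "\<zero>\<^bsub>ring_of_type_algebra\<^esub> = 0"
  by (simp_all add: ring_of_type_algebra_def)

lemma ideal_ring_of_type_algebra_iff:
  fixes J :: "'a::comm_ring_1 set"
  shows "ideal J ring_of_type_algebra \<longleftrightarrow>
    0 \<in> J \<and> (\<forall>x\<in>J. \<forall>y\<in>J. x + y \<in> J) \<and> (\<forall>x\<in>J. \<forall>y. y * x \<in> J)"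
proof
  assume "ideal J ring_of_type_algebra"
  then interpret ideal J "ring_of_type_algebra :: 'a ring" .
  show "0 \<in> J \<and> (\<forall>x\<in>J. \<forall>y\<in>J. x + y \<in> J) \<and> (\<forall>x\<in>J. \<forall>y. y * x \<in> J)"
    using additive_subgroup.zero_closed[OF additive_subgroup_axioms]
      additive_subgroup.a_closed[OF additive_subgroup_axioms] I_l_closed by simp
next
  assume J: "0 \<in> J \<and> (\<forall>x\<in>J. \<forall>y\<in>J. x + y \<in> J) \<and> (\<forall>x\<in>J. \<forall>y. y * x \<in> J)"
  interpret cring "ring_of_type_algebra :: 'a ring" by (rule cring_from_type_algebra)
  have neg: "\<ominus>\<^bsub>ring_of_type_algebra\<^esub> x = - x" for x :: 'a
    by (rule sum_zero_eq_neg[symmetric]) auto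
  show "ideal J ring_of_type_algebra"
  proof (rule idealI)
    show "subgroup J (add_monoid (ring_of_type_algebra :: 'a ring))"
    proof (rule add.subgroupI)
      show "\<ominus>\<^bsub>ring_of_type_algebra\<^esub> x \<in> J" if "x \<in> J" for x
        using J that unfolding neg by (metis mult_minus1)
    qed (use J in auto)
  qed (use J in \<open>auto simp: mult.commute ring_axioms\<close>)
qed

lemma primeideal_ring_of_type_algebra_iff:
  fixes J :: "'a::comm_ring_1 set"
  shows "primeideal J ring_of_type_algebra \<longleftrightarrow>
    ideal J ring_of_type_algebra \<and> J \<noteq> UNIV \<and> (\<forall>x y. x * y \<in> J \<longrightarrow> x \<in> J \<or> y \<in> J)"
proof
  assume "primeideal J ring_of_type_algebra"
  then interpret primeideal J "ring_of_type_algebra :: 'a ring" .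
  show "ideal J ring_of_type_algebra \<and> J \<noteq> UNIV \<and> (\<forall>x y. x * y \<in> J \<longrightarrow> x \<in> J \<or> y \<in> J)"
    using I_notcarr I_prime is_ideal by auto
next
  assume "ideal J ring_of_type_algebra \<and> J \<noteq> UNIV \<and> (\<forall>x y. x * y \<in> J \<longrightarrow> x \<in> J \<or> y \<in> J)"
  then show "primeideal J ring_of_type_algebra"
    by (intro primeidealI cring_from_type_algebra) auto
qed

context
  fixes J :: "'a::comm_ring_1 set"
  assumes J: "ideal J ring_of_type_algebra"
begin

lemma ideal_zero: "0 \<in> J"
  and ideal_add: "x \<in> J \<Longrightarrow> y \<in> J \<Longrightarrow> x + y \<in> J"
  and ideal_mult: "x \<in> J \<Longrightarrow> y * x \<in> J"
  using J by (auto simp: ideal_ring_of_type_algebra_iff)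

lemma ideal_mult_right: "x \<in> J \<Longrightarrow> x * y \<in> J"
  using ideal_mult[of x y] by (simp add: mult.commute)

lemma ideal_diff: "x \<in> J \<Longrightarrow> y \<in> J \<Longrightarrow> x - y \<in> J"
  using ideal_add[of x "-1 * y"] ideal_mult[of y "-1"] by simp

lemma ideal_sum: "(\<And>x. x \<in> A \<Longrightarrow> h x \<in> J) \<Longrightarrow> sum h A \<in> J"
  by (induction A rule: infinite_finite_induct) (auto intro: ideal_zero ideal_add)

lemma ideal_eq_UNIV: "1 \<in> J \<Longrightarrow> J = UNIV"
  using ideal_mult[of 1] by auto

end

lemma primeideal_prod:
  fixes h :: "'b \<Rightarrow> 'a::comm_ring_1"
  assumes P: "primeideal P ring_of_type_algebra" and "finite A" "prod h A \<in> P"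
  shows "\<exists>x\<in>A. h x \<in> P"
  using assms(2,3)
proof (induction A)
  case empty
  with P show ?case
    using ideal_eq_UNIV[of P] by (auto simp: primeideal_ring_of_type_algebra_iff)
next
  case (insert x A)
  with P show ?case by (auto simp: primeideal_ring_of_type_algebra_iff)
qed

lemma
  fixes G :: "'a::comm_ring_1 set"
  shows ideal_genideal: "ideal (Idl\<^bsub>ring_of_type_algebra\<^esub> G) ring_of_type_algebra"
    and genideal_superset: "G \<subseteq> Idl\<^bsub>ring_of_type_algebra\<^esub> G"
    and genideal_subset: "ideal J ring_of_type_algebra \<Longrightarrow> G \<subseteq> J \<Longrightarrow> Idl\<^bsub>ring_of_type_algebra\<^esub> G \<subseteq> J"
proof -
  interpret ring "ring_of_type_algebra :: 'a ring" by (rule ring_from_type_algebra)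
  show "ideal (Idl\<^bsub>ring_of_type_algebra\<^esub> G) ring_of_type_algebra"
    by (rule genideal_ideal) simp
  show "G \<subseteq> Idl\<^bsub>ring_of_type_algebra\<^esub> G" by (rule genideal_self) simp
  show "Idl\<^bsub>ring_of_type_algebra\<^esub> G \<subseteq> J" if "ideal J ring_of_type_algebra" "G \<subseteq> J"
    using that by (rule genideal_minimal)
qed

section \<open>The prime ideal of a point and the vanishing ideal\<close>

text \<open>For \<open>\<alpha> \<noteq> 0\<close> this is the homogeneous prime ideal of the projective point \<open>[\<alpha>]\<close>. It is prime
because it is the kernel of a homomorphism into a domain.\<close>

definition line_ideal :: "'k::field ^ 'n::finite \<Rightarrow> ('n, 'k) mvpoly set" where
  "line_ideal \<alpha> = {f. line_restriction \<alpha> f = 0}"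

lemma ideal_line_ideal: "ideal (line_ideal \<alpha>) ring_of_type_algebra"
  by (simp add: ideal_ring_of_type_algebra_iff line_ideal_def)

lemma primeideal_line_ideal: "primeideal (line_ideal \<alpha>) ring_of_type_algebra"
proof -
  have "1 \<notin> line_ideal \<alpha>" by (simp add: line_ideal_def)
  then show ?thesis
    by (auto simp: primeideal_ring_of_type_algebra_iff ideal_line_ideal) (auto simp: line_ideal_def)
qed

lemma line_ideal_scale: "c \<noteq> 0 \<Longrightarrow> line_ideal (c *s \<alpha>) = line_ideal \<alpha>"
  by (simp add: line_ideal_def line_restriction_scale_eq_0_iff)

lemma homogeneous_in_line_ideal_iff: "homogeneous f \<Longrightarrow> f \<in> line_ideal \<alpha> \<longleftrightarrow> eval f \<alpha> = 0"
  by (simp add: line_ideal_def line_restriction_homogeneous_eq_0_iff)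

lemma ideal_INT_line_ideal: "ideal (\<Inter>\<alpha>\<in>A. line_ideal \<alpha>) ring_of_type_algebra"
  by (simp add: ideal_ring_of_type_algebra_iff line_ideal_def)

text \<open>If the restriction of \<open>f\<close> to a line is zero then so is each of its coefficients, and these are the
values of the homogeneous components of \<open>f\<close>. Hence a polynomial in the intersection is a sum of
generators of the left-hand side.\<close>

lemma genideal_homogeneous_vanishing:
  "Idl\<^bsub>ring_of_type_algebra\<^esub> {f. homogeneous f \<and> (\<forall>\<alpha>\<in>A. eval f \<alpha> = 0)} = (\<Inter>\<alpha>\<in>A. line_ideal \<alpha>)"
    (is "Idl\<^bsub>_\<^esub> ?G = ?R")
proof
  show "Idl\<^bsub>ring_of_type_algebra\<^esub> ?G \<subseteq> ?R"
    by (rule genideal_subset[OF ideal_INT_line_ideal]) (auto simp: homogeneous_in_line_ideal_iff)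
  show "?R \<subseteq> Idl\<^bsub>ring_of_type_algebra\<^esub> ?G"
  proof
    fix f assume "f \<in> ?R"
    then have "homogeneous_component d f \<in> ?G" for d
      by (auto simp: eval_homogeneous_component line_ideal_def homogeneous_def
          intro: homogeneous_component_graded)
    then have "homogeneous_component d f \<in> Idl\<^bsub>ring_of_type_algebra\<^esub> ?G" for d
      using genideal_superset by blast
    then have "(\<Sum>d\<in>(\<lambda>m. \<Sum>i\<in>UNIV. Poly_Mapping.lookup m i) ` Poly_Mapping.keys f.
        homogeneous_component d f) \<in> Idl\<^bsub>ring_of_type_algebra\<^esub> ?G"
      by (intro ideal_sum ideal_genideal)
    then show "f \<in> Idl\<^bsub>ring_of_type_algebra\<^esub> ?G" by (simp only: sum_homogeneous_components)
  qed
qed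

section \<open>Representatives of projective points\<close>

definition proj_rep :: "('k::field ^ 'n::finite) set \<Rightarrow> 'k ^ 'n" where
  "proj_rep p = (SOME \<alpha>. \<alpha> \<in> p)"

lemma equiv_proportional:
  "equiv (UNIV - {0}) (proportional :: (('k::field ^ 'n::finite) \<times> ('k ^ 'n)) set)"
proof (rule equivI)
  show "refl_on (UNIV - {0}) (proportional :: (('k ^ 'n) \<times> ('k ^ 'n)) set)"
    by (auto simp: refl_on_def proportional_def intro!: exI[of _ 1])
  show "sym (proportional :: (('k ^ 'n) \<times> ('k ^ 'n)) set)"
  proof (rule symI)
    fix \<alpha> \<beta> :: "'k ^ 'n" assume "(\<alpha>, \<beta>) \<in> proportional"
    then obtain c where "\<alpha> \<noteq> 0" "\<beta> \<noteq> 0" "c \<noteq> 0" "\<beta> = c *s \<alpha>"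
      by (auto simp: proportional_def)
    then show "(\<beta>, \<alpha>) \<in> proportional"
      by (auto simp: proportional_def vector_smult_assoc intro!: exI[of _ "inverse c"])
  qed
  show "trans (proportional :: (('k ^ 'n) \<times> ('k ^ 'n)) set)"
  proof (rule transI)
    fix \<alpha> \<beta> \<gamma> :: "'k ^ 'n"
    assume "(\<alpha>, \<beta>) \<in> proportional" "(\<beta>, \<gamma>) \<in> proportional"
    then obtain c d where "\<alpha> \<noteq> 0" "\<gamma> \<noteq> 0" "c \<noteq> 0" "d \<noteq> 0" "\<beta> = c *s \<alpha>" "\<gamma> = d *s \<beta>"
      by (auto simp: proportional_def)
    then show "(\<alpha>, \<gamma>) \<in> proportional"
      by (auto simp: proportional_def vector_smult_assoc intro!: exI[of _ "d * c"])
  qed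
qed (auto simp: proportional_def)

lemma proj_rep_in: "p \<in> proj_space \<Longrightarrow> proj_rep p \<in> p"
  unfolding proj_rep_def proj_space_def
  using in_quotient_imp_non_empty[OF equiv_proportional] by (metis some_in_eq)

lemma proj_rep_nonzero: "p \<in> proj_space \<Longrightarrow> proj_rep p \<noteq> 0"
  using proj_rep_in[of p] in_quotient_imp_subset[OF equiv_proportional, of p]
  by (auto simp: proj_space_def)

lemma proj_rep_proportional_imp_eq:
  assumes "p \<in> proj_space" "q \<in> proj_space" "(proj_rep p, proj_rep q) \<in> proportional"
  shows "p = q"
  using assms quotient_eqI[OF equiv_proportional, of p q "proj_rep p" "proj_rep q"] proj_rep_in
  by (auto simp: proj_space_def)

text \<open>Independence of the representative comes from the line ideals: proportional vectors span the same
line, hence have the same ideal.\<close>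

lemma vanishes_at_iff:
  assumes "p \<in> proj_space" "homogeneous f"
  shows "vanishes_at f p \<longleftrightarrow> eval f (proj_rep p) = 0"
proof -
  have "eval f \<alpha> = 0" if "eval f (proj_rep p) = 0" "\<alpha> \<in> p" for \<alpha>
  proof -
    have "(proj_rep p, \<alpha>) \<in> proportional"
      using quotient_eq_iff[OF equiv_proportional] that assms(1) proj_rep_in[OF assms(1)]
      by (metis proj_space_def)
    then obtain c where "c \<noteq> 0" "\<alpha> = c *s proj_rep p"
      by (auto simp: proportional_def)
    with that assms(2) show ?thesis
      by (metis homogeneous_in_line_ideal_iff line_ideal_scale)
  qed
  then show ?thesis
    using proj_rep_in[OF assms(1)] by (auto simp: vanishes_at_def)
qed

lemma vanishing_ideal_eq:
  assumes "\<X> \<subseteq> proj_space"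
  shows "vanishing_ideal \<X> = (\<Inter>\<alpha>\<in>proj_rep ` \<X>. line_ideal \<alpha>)"
proof -
  have "{f. homogeneous f \<and> (\<forall>p\<in>\<X>. vanishes_at f p)} =
      {f. homogeneous f \<and> (\<forall>\<alpha>\<in>proj_rep ` \<X>. eval f \<alpha> = 0)}"
    using assms by (auto simp: vanishes_at_iff subset_iff)
  then show ?thesis
    unfolding vanishing_ideal_def by (simp only: genideal_homogeneous_vanishing)
qed

section \<open>Forms that separate points\<close>

definition var :: "'n \<Rightarrow> ('n::finite, 'k::field) mvpoly" where
  "var i = Poly_Mapping.single (Poly_Mapping.single i 1) 1"

lemma sum_lookup_single: "(\<Sum>j\<in>UNIV. Poly_Mapping.lookup (Poly_Mapping.single (i::'n::finite) (c::nat)) j) = c"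
  by (simp add: lookup_single when_def)

lemma var_graded: "var i \<in> graded_part 1"
  by (simp add: var_def graded_part_def sum_lookup_single)

lemma line_restriction_var: "line_restriction \<alpha> (var i) = Polynomial.monom (\<alpha> $ i) 1"
proof -
  have "(\<Prod>j\<in>UNIV. (\<alpha> $ j) ^ Poly_Mapping.lookup (Poly_Mapping.single i 1) j) =
      (\<Prod>j\<in>UNIV. if j = i then \<alpha> $ i else 1)"
    by (rule prod.cong) (auto simp: lookup_single)
  then have "(\<Prod>j\<in>UNIV. (\<alpha> $ j) ^ Poly_Mapping.lookup (Poly_Mapping.single i 1) j) = \<alpha> $ i"
    by simp
  then show ?thesis
    unfolding var_def line_restriction_single sum_lookup_single by simp
qed

lemma eval_var [simp]: "eval (var i) \<alpha> = \<alpha> $ i"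
  by (simp add: eval_eq_poly line_restriction_var poly_monom)

text \<open>If all \<open>2 \<times> 2\<close> minors of the matrix with rows \<open>\<alpha>\<close> and \<open>\<beta>\<close> vanished, the two vectors would be
proportional; a nonzero minor gives the form \<open>\<beta>\<^sub>j t\<^sub>i - \<beta>\<^sub>i t\<^sub>j\<close>.\<close>

lemma exists_linear_form_separating:
  assumes "\<alpha> \<noteq> 0" "\<beta> \<noteq> 0" "(\<alpha>, \<beta>) \<notin> proportional"
  shows "\<exists>l\<in>graded_part 1. eval l \<alpha> \<noteq> 0 \<and> eval l \<beta> = 0"
proof -
  have "\<exists>i j. \<beta> $ j * \<alpha> $ i \<noteq> \<beta> $ i * \<alpha> $ j"
  proof (rule ccontr)
    assume "\<nexists>i j. \<beta> $ j * \<alpha> $ i \<noteq> \<beta> $ i * \<alpha> $ j"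
    then have *: "\<beta> $ j * \<alpha> $ i = \<beta> $ i * \<alpha> $ j" for i j by blast
    from \<open>\<alpha> \<noteq> 0\<close> obtain i where i: "\<alpha> $ i \<noteq> 0" by (auto simp: vec_eq_iff)
    have "\<beta> = (\<beta> $ i / \<alpha> $ i) *s \<alpha>"
      using *[of _ i] i by (auto simp: vec_eq_iff field_simps)
    with assms show False
      by (metis (mono_tags, lifting) case_prodI mem_Collect_eq proportional_def vector_smult_lzero)
  qed
  then obtain i j where "\<beta> $ j * \<alpha> $ i \<noteq> \<beta> $ i * \<alpha> $ j" by blast
  then show ?thesis
    by (intro bexI[of _ "const (\<beta> $ j) * var i - const (\<beta> $ i) * var j"])
      (use var_graded in \<open>auto intro!: graded_part_diff graded_part_const_mult\<close>)
qed

text \<open>The product of one separating linear form for each \<open>\<beta> \<in> B\<close> has degree \<open>card B\<close>. Multiplying by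
powers of a variable that is nonzero at \<open>\<alpha>\<close> reaches every higher degree.\<close>

lemma exists_separator:
  fixes \<alpha> :: "'k::field ^ 'n::finite"
  assumes "finite B" "\<alpha> \<noteq> 0" "0 \<notin> B" "\<And>\<beta>. \<beta> \<in> B \<Longrightarrow> (\<alpha>, \<beta>) \<notin> proportional" "card B \<le> d"
  shows "\<exists>e\<in>graded_part d. eval e \<alpha> = 1 \<and> (\<forall>\<beta>\<in>B. eval e \<beta> = 0)"
proof -
  have "\<forall>\<beta>\<in>B. \<exists>l\<in>graded_part 1. eval l \<alpha> \<noteq> 0 \<and> eval l \<beta> = 0"
    using assms exists_linear_form_separating by metis
  then obtain l where l: "\<And>\<beta>. \<beta> \<in> B \<Longrightarrow> l \<beta> \<in> graded_part 1"
    "\<And>\<beta>. \<beta> \<in> B \<Longrightarrow> eval (l \<beta>) \<alpha> \<noteq> 0" "\<And>\<beta>. \<beta> \<in> B \<Longrightarrow> eval (l \<beta>) \<beta> = 0"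
    by metis
  from \<open>\<alpha> \<noteq> 0\<close> obtain i where i: "\<alpha> $ i \<noteq> 0" by (auto simp: vec_eq_iff)
  define g where "g = prod l B * var i ^ (d - card B)"
  have "g \<in> graded_part (card B * 1 + (d - card B) * 1)"
    unfolding g_def using l(1) assms(1) var_graded
    by (intro graded_part_mult graded_part_prod graded_part_power) auto
  then have g: "g \<in> graded_part d" using assms(5) by simp
  have "eval g \<alpha> \<noteq> 0" using l(2) i assms(1) by (auto simp: g_def)
  moreover have "eval g \<beta> = 0" if "\<beta> \<in> B" for \<beta>
    using l(3) that assms(1) by (auto simp: g_def)
  ultimately show ?thesis
    using g by (intro bexI[of _ "const (inverse (eval g \<alpha>)) * g"]) (auto intro: graded_part_const_mult)
qed

definition projectively_distinct :: "('k::field ^ 'n::finite) set \<Rightarrow> bool" where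
  "projectively_distinct A \<longleftrightarrow>
     0 \<notin> A \<and> (\<forall>\<alpha>\<in>A. \<forall>\<beta>\<in>A. (\<alpha>, \<beta>) \<in> proportional \<longrightarrow> \<alpha> = \<beta>)"

lemma projectively_distinct_subset:
  "projectively_distinct A \<Longrightarrow> B \<subseteq> A \<Longrightarrow> projectively_distinct B"
  by (auto simp: projectively_distinct_def)

text \<open>Evaluation of forms of degree \<open>d\<close> at the points of \<open>A\<close> is thus onto \<open>K\<^sup>A\<close> once
\<open>d \<ge> card A\<close>: the forms \<open>e \<alpha>\<close> are mapped to the standard basis.\<close>

lemma exists_dual_forms:
  assumes "finite A" "projectively_distinct A" "card A \<le> d"
  shows "\<exists>e. \<forall>\<alpha>\<in>A. e \<alpha> \<in> graded_part d \<and> (\<forall>\<beta>\<in>A. eval (e \<alpha>) \<beta> = (if \<beta> = \<alpha> then 1 else 0))"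
proof -
  have "\<exists>e. e \<in> graded_part d \<and> (\<forall>\<beta>\<in>A. eval e \<beta> = (if \<beta> = \<alpha> then 1 else 0))" if "\<alpha> \<in> A" for \<alpha>
  proof -
    have "card (A - {\<alpha>}) \<le> d" using assms by (meson card_Diff1_le order_trans)
    then have "\<exists>e\<in>graded_part d. eval e \<alpha> = 1 \<and> (\<forall>\<beta>\<in>A - {\<alpha>}. eval e \<beta> = 0)"
      using assms that by (intro exists_separator) (auto simp: projectively_distinct_def)
    then obtain e where "e \<in> graded_part d" "eval e \<alpha> = 1" "\<forall>\<beta>\<in>A - {\<alpha>}. eval e \<beta> = 0" by blast
    then show ?thesis by (intro exI[of _ e]) auto
  qed
  then show ?thesis by metis
qed

section \<open>Dimensions of quotient spaces\<close>

interpretation mv: vector_space "\<lambda>c (f :: ('n::finite, 'k::field) mvpoly). const c * f"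
  by unfold_locales
    (auto simp: const_def single_add mult_single algebra_simps simp flip: mult.assoc)

text \<open>The span of \<open>E\<close> meets \<open>W\<close> only in \<open>0\<close>, so it is a copy of \<open>V / W\<close> inside the
polynomial ring. Moving each element of \<open>B\<close> to the element of \<open>mv.span E\<close> in its class makes
\<open>B\<close> a second basis of this copy, and two bases of a subspace have the same cardinality.\<close>

lemma card_quot_basis_unique:
  fixes V W :: "('n::finite, 'k::field) mvpoly set"
  assumes W: "mv.subspace W" and B: "quot_basis V W B" and E: "quot_basis V W E"
  shows "card B = card E"
proof -
  note B = B[unfolded quot_basis_def] and E = E[unfolded quot_basis_def]
  have indB: "c b = 0" if "finite A" "A \<subseteq> B" "(\<Sum>b\<in>A. const (c b) * b) \<in> W" "b \<in> A" for A c b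
    using B that by blast
  have indE: "c b = 0" if "finite A" "A \<subseteq> E" "(\<Sum>b\<in>A. const (c b) * b) \<in> W" "b \<in> A" for A c b
    using E that by blast
  have span_E_W: "x = 0" if "x \<in> mv.span E" "x \<in> W" for x
  proof -
    from that(1) obtain A c where "finite A" "A \<subseteq> E" "x = (\<Sum>b\<in>A. const (c b) * b)"
      by (auto simp: mv.span_explicit)
    then show "x = 0" using that(2) indE[of A c] by (simp add: const_def)
  qed
  have "\<exists>y\<in>mv.span E. b - y \<in> W" if "b \<in> B" for b
  proof -
    from that B E obtain A c where "finite A" "A \<subseteq> E" "b - (\<Sum>b\<in>A. const (c b) * b) \<in> W"
      by (meson subsetD)
    then show ?thesis
      by (intro bexI[of _ "\<Sum>b\<in>A. const (c b) * b"])
        (auto intro!: mv.span_sum mv.span_scale intro: mv.span_base)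
  qed
  then obtain \<pi> where \<pi>: "\<And>b. b \<in> B \<Longrightarrow> \<pi> b \<in> mv.span E" "\<And>b. b \<in> B \<Longrightarrow> b - \<pi> b \<in> W"
    by metis
  \<comment> \<open>Linear combinations of elements of \<open>B\<close> keep their class when \<open>\<pi>\<close> is applied to each term.\<close>
  have \<pi>_sum: "(\<Sum>b\<in>A. const (c b) * b) - (\<Sum>b\<in>A. const (c b) * \<pi> b) \<in> W" if "A \<subseteq> B" for A c
  proof -
    have "(\<Sum>b\<in>A. const (c b) * (b - \<pi> b)) \<in> W"
      using that \<pi>(2) by (intro mv.subspace_sum[OF W] mv.subspace_scale[OF W]) auto
    then show ?thesis by (simp add: right_diff_distrib sum_subtractf)
  qed
  have inj: "inj_on \<pi> B"
  proof (rule inj_onI, rule ccontr)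
    fix x y assume xy: "x \<in> B" "y \<in> B" "\<pi> x = \<pi> y" "x \<noteq> y"
    \<comment> \<open>Otherwise \<open>x - y\<close> lies in \<open>W\<close>, a nontrivial relation between classes of elements of \<open>B\<close>.\<close>
    let ?c = "\<lambda>z. if z = x then 1 else - 1 :: 'k"
    have "(\<Sum>b\<in>{x,y}. const (?c b) * \<pi> b) = 0"
      using xy by (simp add: const_def single_uminus)
    then have "(\<Sum>b\<in>{x,y}. const (?c b) * b) \<in> W"
      using \<pi>_sum[of "{x,y}" ?c] xy(1,2) by simp
    then have "?c x = 0" using indB[of "{x,y}" ?c x] xy by blast
    then show False by simp
  qed
  have "mv.independent (\<pi> ` B)"
    unfolding mv.dependent_explicit
  proof clarify
    fix t u v assume t: "finite t" "t \<subseteq> \<pi> ` B" "(\<Sum>v\<in>t. const (u v) * v) = 0" and v: "v \<in> t" "u v \<noteq> 0"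
    from t(1,2) obtain A where A: "A \<subseteq> B" "finite A" "t = \<pi> ` A"
      by (meson finite_subset_image)
    have "(\<Sum>b\<in>A. const (u (\<pi> b)) * \<pi> b) = 0"
      using t(3) A inj by (simp add: sum.reindex inj_on_subset)
    with \<pi>_sum[OF A(1), of "\<lambda>b. u (\<pi> b)"] have *: "(\<Sum>b\<in>A. const (u (\<pi> b)) * b) \<in> W" by simp
    from v(1) A(3) obtain b where "b \<in> A" "v = \<pi> b" by blast
    with indB[OF A(2,1) *] v(2) show False by simp
  qed
  moreover have "mv.independent E"
    unfolding mv.dependent_explicit
  proof clarify
    fix t u v assume t: "finite t" "t \<subseteq> E" "(\<Sum>v\<in>t. const (u v) * v) = 0" and v: "v \<in> t" "u v \<noteq> 0"
    with indE[OF t(1,2), of u v] mv.subspace_0[OF W] show False by simp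
  qed
  moreover have "E \<subseteq> mv.span (\<pi> ` B)"
  proof
    fix e assume e: "e \<in> E"
    with E B obtain A c where A: "finite A" "A \<subseteq> B" "e - (\<Sum>b\<in>A. const (c b) * b) \<in> W"
      by (meson subsetD)
    let ?x = "e - (\<Sum>b\<in>A. const (c b) * \<pi> b)"
    have "?x \<in> W"
      using mv.subspace_add[OF W A(3) \<pi>_sum[OF A(2), of c]] by simp
    moreover have "?x \<in> mv.span E"
      using e A(2) \<pi>(1) by (intro mv.span_diff mv.span_sum mv.span_scale) (auto intro: mv.span_base)
    ultimately have "?x = 0" by (intro span_E_W)
    then have "e = (\<Sum>b\<in>A. const (c b) * \<pi> b)" by simp
    also have "\<dots> \<in> mv.span (\<pi> ` B)"
      using A(2) by (intro mv.span_sum mv.span_scale mv.span_base) auto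
    finally show "e \<in> mv.span (\<pi> ` B)" .
  qed
  then have "mv.span E \<subseteq> mv.span (\<pi> ` B)" by (intro mv.span_minimal mv.subspace_span)
  moreover have "\<pi> ` B \<subseteq> mv.span E" using \<pi>(1) by blast
  ultimately have "card (\<pi> ` B) = mv.dim (mv.span E)" "card E = mv.dim (mv.span E)"
    using mv.basis_card_eq_dim[of "\<pi> ` B" "mv.span E"] mv.basis_card_eq_dim[of E "mv.span E"]
      mv.span_superset[of E] by auto
  then show ?thesis using card_image[OF inj] by simp
qed

text \<open>The definition of \<^const>\<open>quot_dim\<close> picks an unspecified
basis; uniqueness of the cardinality turns any concrete one into the value.\<close>

lemma quot_dim_eq_card:
  assumes "mv.subspace W" "quot_basis V W E"
  shows "quot_dim V W = card E"
  unfolding quot_dim_def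
  by (rule card_quot_basis_unique[OF assms(1) _ assms(2)]) (rule someI[of "quot_basis V W", OF assms(2)])

section \<open>The Hilbert function of a set of points\<close>

lemma graded_part_in_INT_line_ideal_iff:
  "f \<in> graded_part d \<Longrightarrow> f \<in> (\<Inter>\<alpha>\<in>A. line_ideal \<alpha>) \<longleftrightarrow> (\<forall>\<alpha>\<in>A. eval f \<alpha> = 0)"
  by (subst INT_iff, subst homogeneous_in_line_ideal_iff) (auto simp: homogeneous_def)

text \<open>The dual forms are a basis of the degree \<open>d\<close> part modulo the forms vanishing on \<open>A\<close>: the
coefficient of \<open>e \<alpha>\<close> in a form is its value at \<open>\<alpha>\<close>.\<close>

lemma hilbert_fun_points:
  fixes A :: "('k::field ^ 'n::finite) set"
  assumes "finite A" "projectively_distinct A" "card A \<le> d"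
  shows "hilbert_fun (\<Inter>\<alpha>\<in>A. line_ideal \<alpha>) d = card A"
proof -
  let ?W = "(\<Inter>\<alpha>\<in>A. line_ideal \<alpha>) \<inter> graded_part d"
  have W_iff: "f \<in> ?W \<longleftrightarrow> f \<in> graded_part d \<and> (\<forall>\<alpha>\<in>A. eval f \<alpha> = 0)" for f
    using graded_part_in_INT_line_ideal_iff by blast
  obtain e where e: "\<And>\<alpha>. \<alpha> \<in> A \<Longrightarrow> e \<alpha> \<in> graded_part d"
    "\<And>\<alpha> \<beta>. \<alpha> \<in> A \<Longrightarrow> \<beta> \<in> A \<Longrightarrow> eval (e \<alpha>) \<beta> = (if \<beta> = \<alpha> then 1 else 0)"
    using exists_dual_forms[OF assms] by metis
  have inj: "inj_on e A"
    by (rule inj_onI) (metis e(2) zero_neq_one)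
  have "mv.subspace ?W"
    unfolding mv.subspace_def
    by (auto simp only: Ball_def W_iff intro!: graded_part_add graded_part_const_mult graded_part_0)
      simp_all
  moreover have "quot_basis (graded_part d) ?W (e ` A)"
    unfolding quot_basis_def
  proof (intro conjI allI impI ballI)
    show "e ` A \<subseteq> graded_part d" using e(1) by blast
  next
    fix T c b
    assume T: "finite T \<and> T \<subseteq> e ` A \<and> (\<Sum>b\<in>T. const (c b) * b) \<in> ?W" and "b \<in> T"
    then obtain \<alpha> where \<alpha>: "\<alpha> \<in> A" "b = e \<alpha>" by blast
    have "eval (\<Sum>b\<in>T. const (c b) * b) \<alpha> = (\<Sum>b'\<in>T. if b' = b then c b' else 0)"
      unfolding eval_simps
    proof (rule sum.cong)
      fix b' assume "b' \<in> T"
      with T obtain \<beta> where "\<beta> \<in> A" "b' = e \<beta>" by blast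
      then show "c b' * eval b' \<alpha> = (if b' = b then c b' else 0)"
        using \<alpha> e(2)[of \<beta> \<alpha>] inj by (auto dest: inj_onD)
    qed simp
    also have "\<dots> = c b" using T \<open>b \<in> T\<close> by simp
    finally show "c b = 0" using T \<alpha>(1) W_iff by auto
  next
    fix v :: "('n, 'k) mvpoly" assume v: "v \<in> graded_part d"
    let ?c = "\<lambda>b. eval v (inv_into A e b)"
    have "v - (\<Sum>\<alpha>\<in>A. const (eval v \<alpha>) * e \<alpha>) \<in> ?W"
      unfolding W_iff
    proof (intro conjI ballI)
      show "v - (\<Sum>\<alpha>\<in>A. const (eval v \<alpha>) * e \<alpha>) \<in> graded_part d"
        using v e(1) by (intro graded_part_diff graded_part_sum graded_part_const_mult)
      fix \<beta> assume \<beta>: "\<beta> \<in> A"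
      have "(\<Sum>\<alpha>\<in>A. eval v \<alpha> * eval (e \<alpha>) \<beta>) = (\<Sum>\<alpha>\<in>A. if \<beta> = \<alpha> then eval v \<alpha> else 0)"
        using \<beta> by (intro sum.cong) (auto simp: e(2))
      then show "eval (v - (\<Sum>\<alpha>\<in>A. const (eval v \<alpha>) * e \<alpha>)) \<beta> = 0"
        using assms(1) \<beta> by simp
    qed
    also have "(\<Sum>\<alpha>\<in>A. const (eval v \<alpha>) * e \<alpha>) = (\<Sum>b\<in>e ` A. const (?c b) * b)"
      by (simp add: sum.reindex[OF inj] inv_into_f_f[OF inj])
    finally show "\<exists>T c. finite T \<and> T \<subseteq> e ` A \<and> v - (\<Sum>b\<in>T. const (c b) * b) \<in> ?W"
      using assms(1) by (intro exI[of _ "e ` A"] exI[of _ ?c]) auto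
  qed
  ultimately have "quot_dim (graded_part d) ?W = card (e ` A)" by (rule quot_dim_eq_card)
  then show ?thesis unfolding hilbert_fun_def by (simp add: card_image[OF inj])
qed

text \<open>In high degree, adjoining \<open>F\<close> to the ideal of the points \<open>A\<close> gives the full ideal of the common
zeros of \<open>F\<close> in \<open>A\<close>; in general the two ideals differ in low degrees. Modulo the ideal of
\<open>A\<close> a form is a combination of the dual forms, with its values as coefficients. At a point \<open>\<alpha>\<close>
where some \<open>\<phi> \<in> F\<close> does not vanish, the dual form is congruent to a multiple of \<open>\<phi>\<close>: the product
of \<open>\<phi>\<close> with a dual form of lower degree has, up to a scalar, the same values on \<open>A\<close>. So a form
that vanishes at the common zeros only involves dual forms that lie in the ideal.\<close>

lemma genideal_points_eventually_eq:
  fixes A :: "('k::field ^ 'n::finite) set" and F :: "('n, 'k) mvpoly set"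
  assumes A: "finite A" "projectively_distinct A"
    and F: "finite F" "\<And>f. f \<in> F \<Longrightarrow> homogeneous f"
  shows "\<exists>N. \<forall>d\<ge>N. Idl\<^bsub>ring_of_type_algebra\<^esub> ((\<Inter>\<alpha>\<in>A. line_ideal \<alpha>) \<union> F) \<inter> graded_part d =
    (\<Inter>\<alpha>\<in>{\<alpha>\<in>A. \<forall>f\<in>F. eval f \<alpha> = 0}. line_ideal \<alpha>) \<inter> graded_part d"
proof -
  let ?I = "\<Inter>\<alpha>\<in>A. line_ideal \<alpha>"
  let ?V = "{\<alpha>\<in>A. \<forall>f\<in>F. eval f \<alpha> = 0}"
  let ?J = "Idl\<^bsub>ring_of_type_algebra\<^esub> (?I \<union> F)"
  have J: "ideal ?J ring_of_type_algebra" "?I \<subseteq> ?J" "F \<subseteq> ?J"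
    using ideal_genideal genideal_superset[of "?I \<union> F"] by auto
  have J_sub: "?J \<subseteq> (\<Inter>\<alpha>\<in>?V. line_ideal \<alpha>)"
    by (rule genideal_subset[OF ideal_INT_line_ideal]) (use F(2) homogeneous_in_line_ideal_iff in auto)
  from F(2) obtain \<delta> where \<delta>: "\<And>f. f \<in> F \<Longrightarrow> f \<in> graded_part (\<delta> f)"
    unfolding homogeneous_def by metis
  \<comment> \<open>Dual forms must exist in degree \<open>d - \<delta> \<phi>\<close> for every \<open>\<phi> \<in> F\<close>; the sum of the degrees is
    an upper bound for all of them.\<close>
  define N where "N = card A + sum \<delta> F"
  have "f \<in> ?J" if d: "N \<le> d" and f: "f \<in> graded_part d" "\<And>\<alpha>. \<alpha> \<in> ?V \<Longrightarrow> eval f \<alpha> = 0" for d f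
  proof -
    obtain e where e: "\<And>\<alpha>. \<alpha> \<in> A \<Longrightarrow> e \<alpha> \<in> graded_part d"
      "\<And>\<alpha> \<beta>. \<alpha> \<in> A \<Longrightarrow> \<beta> \<in> A \<Longrightarrow> eval (e \<alpha>) \<beta> = (if \<beta> = \<alpha> then 1 else 0)"
      using exists_dual_forms[OF A, of d] d unfolding N_def by (metis add_leD1)
    have e_in_J: "e \<alpha> \<in> ?J" if \<alpha>: "\<alpha> \<in> A" "\<alpha> \<notin> ?V" for \<alpha>
    proof -
      from \<alpha> obtain \<phi> where \<phi>: "\<phi> \<in> F" "eval \<phi> \<alpha> \<noteq> 0" by blast
      have "\<delta> \<phi> \<le> sum \<delta> F" using F(1) \<phi>(1) by (intro member_le_sum) auto
      with d have le: "card A \<le> d - \<delta> \<phi>" "\<delta> \<phi> \<le> d" unfolding N_def by auto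
      obtain e' where e': "e' \<in> graded_part (d - \<delta> \<phi>)"
        "\<And>\<beta>. \<beta> \<in> A \<Longrightarrow> eval e' \<beta> = (if \<beta> = \<alpha> then 1 else 0)"
        using exists_dual_forms[OF A le(1)] \<alpha>(1) by metis
      let ?g = "const (inverse (eval \<phi> \<alpha>)) * (e' * \<phi>)"
      have "?g \<in> graded_part d"
        using graded_part_mult[OF e'(1) \<delta>[OF \<phi>(1)]] le(2) by (intro graded_part_const_mult) simp
      then have "e \<alpha> - ?g \<in> ?I"
        using \<alpha>(1) \<phi>(2) e e'(2)
        by (subst graded_part_in_INT_line_ideal_iff[of _ d]) (auto intro: graded_part_diff)
      moreover have "?g \<in> ?J" using J(3) \<phi>(1) by (intro ideal_mult[OF J(1)]) auto
      ultimately have "e \<alpha> - ?g + ?g \<in> ?J" using J(2) by (intro ideal_add[OF J(1)]) auto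
      then show ?thesis by simp
    qed
    let ?s = "\<Sum>\<alpha>\<in>A. const (eval f \<alpha>) * e \<alpha>"
    have "?s \<in> ?J"
    proof (rule ideal_sum[OF J(1)])
      fix \<alpha> assume "\<alpha> \<in> A"
      then show "const (eval f \<alpha>) * e \<alpha> \<in> ?J"
        using f(2)[of \<alpha>] e_in_J[of \<alpha>] ideal_mult[OF J(1)] ideal_zero[OF J(1)]
        by (cases "\<alpha> \<in> ?V") (auto simp: const_def)
    qed
    moreover have "f - ?s \<in> ?I"
    proof (subst graded_part_in_INT_line_ideal_iff[of _ d])
      show "f - ?s \<in> graded_part d"
        using f(1) e(1) by (intro graded_part_diff graded_part_sum graded_part_const_mult)
      show "\<forall>\<beta>\<in>A. eval (f - ?s) \<beta> = 0"
      proof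
        fix \<beta> assume \<beta>: "\<beta> \<in> A"
        have "(\<Sum>\<alpha>\<in>A. eval f \<alpha> * eval (e \<alpha>) \<beta>) = (\<Sum>\<alpha>\<in>A. if \<beta> = \<alpha> then eval f \<alpha> else 0)"
          using \<beta> by (intro sum.cong) (auto simp: e(2))
        then show "eval (f - ?s) \<beta> = 0" using A(1) \<beta> by simp
      qed
    qed
    ultimately have "f - ?s + ?s \<in> ?J" using J(2) by (intro ideal_add[OF J(1)]) auto
    then show ?thesis by simp
  qed
  note in_J = this
  have "?J \<inter> graded_part d = (\<Inter>\<alpha>\<in>?V. line_ideal \<alpha>) \<inter> graded_part d" if "N \<le> d" for d
  proof
    show "?J \<inter> graded_part d \<subseteq> (\<Inter>\<alpha>\<in>?V. line_ideal \<alpha>) \<inter> graded_part d"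
      using J_sub by (rule Int_mono) simp
    show "(\<Inter>\<alpha>\<in>?V. line_ideal \<alpha>) \<inter> graded_part d \<subseteq> ?J \<inter> graded_part d"
    proof
      fix f assume "f \<in> (\<Inter>\<alpha>\<in>?V. line_ideal \<alpha>) \<inter> graded_part d"
      then have f: "f \<in> (\<Inter>\<alpha>\<in>?V. line_ideal \<alpha>)" "f \<in> graded_part d" by (simp_all only: Int_iff)
      then have "\<forall>\<alpha>\<in>?V. eval f \<alpha> = 0" by (simp only: graded_part_in_INT_line_ideal_iff)
      with in_J[OF that f(2)] f(2) show "f \<in> ?J \<inter> graded_part d" by (simp only: IntI)
    qed
  qed
  then show ?thesis by (intro exI[of _ N]) simp
qed

section \<open>Prime ideals of a quotient ring\<close>

lemma (in cring) coset_mem_image_iff: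
  assumes "ideal J R" "ideal Q R" "J \<subseteq> Q" "x \<in> carrier R"
  shows "J +> x \<in> (+>) J ` Q \<longleftrightarrow> x \<in> Q"
proof -
  have "Q \<subseteq> carrier R" using assms(2) by (meson additive_subgroup.a_subset ideal.axioms(1))
  then have "(+>) J ` Q \<subseteq> carrier (R Quot J)"
    by (auto simp: FactRing_def A_RCOSETS_def')
  moreover have "\<Union> ((+>) J ` Q) = Q"
    using ideal_incl_iff[OF assms(1,2)] assms(3) by simp
  ultimately show ?thesis
    using canonical_proj_vimage_mem_iff[OF assms(1) _ assms(4)] by metis
qed

lemma (in cring) primeideal_image_quot:
  assumes J: "ideal J R" and Q: "primeideal Q R" and sub: "J \<subseteq> Q"
  shows "primeideal ((+>) J ` Q) (R Quot J)"
proof -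
  interpret Q: primeideal Q R by fact
  note iff = coset_mem_image_iff[OF J Q.is_ideal sub]
  have carr: "carrier (R Quot J) = (+>) J ` carrier R"
    by (auto simp: FactRing_def A_RCOSETS_def')
  show ?thesis
  proof (rule primeidealI)
    show "ideal ((+>) J ` Q) (R Quot J)" by (rule ring_ideal_imp_quot_ideal[OF J Q.is_ideal])
    show "cring (R Quot J)" by (rule ideal.quotient_is_cring[OF J is_cring])
    show "carrier (R Quot J) \<noteq> (+>) J ` Q"
    proof
      assume "carrier (R Quot J) = (+>) J ` Q"
      then have "x \<in> Q" if "x \<in> carrier R" for x using iff[OF that] that carr by blast
      then show False using Q.I_notcarr Q.a_subset by blast
    qed
    fix a b assume "a \<in> carrier (R Quot J)" "b \<in> carrier (R Quot J)"
      and ab: "a \<otimes>\<^bsub>R Quot J\<^esub> b \<in> (+>) J ` Q"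
    then obtain x y where xy: "x \<in> carrier R" "a = J +> x" "y \<in> carrier R" "b = J +> y"
      unfolding carr by blast
    then have "J +> (x \<otimes> y) \<in> (+>) J ` Q"
      using ab ideal.rcoset_mult_add[OF J] by (simp add: FactRing_def)
    then have "x \<otimes> y \<in> Q" using iff[of "x \<otimes> y"] xy by simp
    then show "a \<in> (+>) J ` Q \<or> b \<in> (+>) J ` Q" using Q.I_prime xy by blast
  qed
qed

lemma (in cring) primeideal_Union_quot:
  assumes J: "ideal J R" and P: "primeideal P (R Quot J)"
  shows "primeideal (\<Union>P) R" "J \<subseteq> \<Union>P"
proof -
  interpret P: primeideal P "R Quot J" by fact
  note iff = canonical_proj_vimage_mem_iff[OF J P.a_subset]
  have carr: "carrier (R Quot J) = (+>) J ` carrier R"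
    by (auto simp: FactRing_def A_RCOSETS_def')
  have "J \<in> P"
    using additive_subgroup.zero_closed[OF P.additive_subgroup_axioms] by (simp add: FactRing_def)
  then show "J \<subseteq> \<Union>P" by blast
  show "primeideal (\<Union>P) R"
  proof (rule primeidealI)
    show "ideal (\<Union>P) R" by (rule quot_ideal_imp_ring_ideal[OF J P.is_ideal])
    show "carrier R \<noteq> \<Union>P"
    proof
      assume "carrier R = \<Union>P"
      then have "carrier (R Quot J) \<subseteq> P" unfolding carr using iff by blast
      then show False using P.I_notcarr P.a_subset by blast
    qed
    fix a b assume ab: "a \<in> carrier R" "b \<in> carrier R" "a \<otimes> b \<in> \<Union>P"
    then have "J +> (a \<otimes> b) \<in> P" using iff[of "a \<otimes> b"] by simp
    then have "(J +> a) \<otimes>\<^bsub>R Quot J\<^esub> (J +> b) \<in> P"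
      using ideal.rcoset_mult_add[OF J] ab by (simp add: FactRing_def)
    then have "J +> a \<in> P \<or> J +> b \<in> P"
      using P.I_prime[of "J +> a" "J +> b"] ab carr by blast
    then show "a \<in> \<Union>P \<or> b \<in> \<Union>P" using iff ab by blast
  qed (rule is_cring)
qed

text \<open>The correspondence \<open>P \<mapsto> \<Union>P\<close>, with inverse \<open>Q \<mapsto> (+>) J ` Q\<close>, between prime ideals of the quotient
and prime ideals containing \<open>J\<close> preserves strict inclusion, so it carries chains to chains.\<close>

lemma (in cring) krull_dim_quot:
  assumes J: "ideal J R"
  shows "krull_dim (R Quot J) = Sup {enat n | n. \<exists>P :: nat \<Rightarrow> 'a set.
     (\<forall>i\<le>n. primeideal (P i) R \<and> J \<subseteq> P i) \<and> (\<forall>i<n. P i \<subset> P (Suc i))}"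
proof -
  have carr: "carrier (R Quot J) = (+>) J ` carrier R"
    by (auto simp: FactRing_def A_RCOSETS_def')
  have "(\<exists>P. (\<forall>i\<le>n. primeideal (P i) (R Quot J)) \<and> (\<forall>i<n. P i \<subset> P (Suc i))) \<longleftrightarrow>
    (\<exists>P. (\<forall>i\<le>n. primeideal (P i) R \<and> J \<subseteq> P i) \<and> (\<forall>i<n. P i \<subset> P (Suc i)))" (is "?L \<longleftrightarrow> ?R") for n
  proof
    assume ?L
    then obtain P where P: "\<And>i. i \<le> n \<Longrightarrow> primeideal (P i) (R Quot J)" "\<And>i. i < n \<Longrightarrow> P i \<subset> P (Suc i)"
      by blast
    have "\<Union>(P i) \<subset> \<Union>(P (Suc i))" if "i < n" for i
    proof -
      interpret P: primeideal "P i" "R Quot J" using P(1) that by simp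
      interpret P': primeideal "P (Suc i)" "R Quot J" using P(1) that by simp
      from P(2)[OF that] obtain a where a: "a \<in> P (Suc i)" "a \<notin> P i" by blast
      then obtain x where "x \<in> carrier R" "a = J +> x"
        using P'.a_subset carr by blast
      with a have "x \<in> \<Union>(P (Suc i))" "x \<notin> \<Union>(P i)"
        using canonical_proj_vimage_mem_iff[OF J P.a_subset, of x]
          canonical_proj_vimage_mem_iff[OF J P'.a_subset, of x] by simp_all
      then show ?thesis using P(2)[OF that] by blast
    qed
    then show ?R
      using primeideal_Union_quot[OF J P(1)] by (intro exI[of _ "\<lambda>i. \<Union>(P i)"]) simp
  next
    assume ?R
    then obtain P where P: "\<And>i. i \<le> n \<Longrightarrow> primeideal (P i) R" "\<And>i. i \<le> n \<Longrightarrow> J \<subseteq> P i"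
      "\<And>i. i < n \<Longrightarrow> P i \<subset> P (Suc i)"
      by blast
    have "(+>) J ` P i \<subset> (+>) J ` P (Suc i)" if "i < n" for i
    proof -
      interpret P: primeideal "P i" R using P(1) that by simp
      interpret P': primeideal "P (Suc i)" R using P(1) that by simp
      from P(3)[OF that] obtain x where x: "x \<in> P (Suc i)" "x \<notin> P i" by blast
      then have "J +> x \<notin> (+>) J ` P i"
        using coset_mem_image_iff[OF J P.is_ideal, of x] P(2) that P'.a_subset by auto
      moreover have "(+>) J ` P i \<subseteq> (+>) J ` P (Suc i)"
        using P(3)[OF that] by (intro image_mono) simp
      ultimately show ?thesis using x(1) by blast
    qed
    then show ?L
      using primeideal_image_quot[OF J P(1,2)] by (intro exI[of _ "\<lambda>i. (+>) J ` P i"]) simp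
  qed
  then show ?thesis unfolding krull_dim_def by simp
qed

section \<open>Chains of prime ideals above an ideal of points\<close>

text \<open>Elements \<open>g\<^sub>i \<in> I\<^sub>i\<close> outside \<open>P\<close> would have a product that lies in every \<open>I\<^sub>i\<close> but not in
\<open>P\<close>.\<close>

lemma primeideal_INT_subset:
  fixes P :: "'a::comm_ring_1 set"
  assumes P: "primeideal P ring_of_type_algebra" and A: "finite A"
    and I: "\<And>i. i \<in> A \<Longrightarrow> ideal (I i) ring_of_type_algebra" and sub: "(\<Inter>i\<in>A. I i) \<subseteq> P"
  shows "\<exists>i\<in>A. I i \<subseteq> P"
proof (rule ccontr)
  assume "\<not> (\<exists>i\<in>A. I i \<subseteq> P)"
  then have "\<forall>i\<in>A. \<exists>x. x \<in> I i \<and> x \<notin> P" by blast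
  then obtain g where g: "\<And>i. i \<in> A \<Longrightarrow> g i \<in> I i" "\<And>i. i \<in> A \<Longrightarrow> g i \<notin> P" by metis
  have "prod g A \<in> I i" if "i \<in> A" for i
    using ideal_mult_right[OF I g(1), OF that that] by (simp add: prod.remove[OF A that])
  then have "prod g A \<in> P" using sub by blast
  then show False using primeideal_prod[OF P A] g(2) by blast
qed

text \<open>Division with remainder by a nonzero element of least
degree.\<close>

lemma poly_ideal_generator:
  fixes P :: "'k::field poly set"
  assumes P: "ideal P ring_of_type_algebra" and ne: "\<exists>f\<in>P. f \<noteq> 0"
  shows "\<exists>g\<in>P. g \<noteq> 0 \<and> (\<forall>f\<in>P. g dvd f)"
proof -
  obtain g where g: "g \<in> P" "g \<noteq> 0" and
    least: "\<And>f. f \<in> P \<Longrightarrow> f \<noteq> 0 \<Longrightarrow> Polynomial.degree g \<le> Polynomial.degree f"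
    using ne ex_has_least_nat[of "\<lambda>f. f \<in> P \<and> f \<noteq> 0" _ Polynomial.degree] by blast
  have "g dvd f" if "f \<in> P" for f
  proof -
    have "f - f div g * g \<in> P" using that g(1) by (intro ideal_diff[OF P] ideal_mult[OF P])
    then have "f mod g \<in> P" by (simp add: minus_div_mult_eq_mod)
    then have "f mod g = 0"
      using least[of "f mod g"] degree_mod_less[OF g(2), of f] by linarith
    then show ?thesis by (rule mod_0_imp_dvd)
  qed
  with g show ?thesis by blast
qed

text \<open>In \<open>K[x]\<close>, let \<open>P = (g)\<close> and \<open>Q = (h)\<close>, so that \<open>g = h k\<close>. Since \<open>h \<notin> P\<close>, primality gives
\<open>k \<in> P\<close>, that is, \<open>g\<close> divides \<open>k\<close>, and therefore \<open>h\<close> is a unit.\<close>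

lemma nonzero_primeideal_poly_maximal:
  fixes P Q :: "'k::field poly set"
  assumes P: "primeideal P ring_of_type_algebra" and ne: "\<exists>f\<in>P. f \<noteq> 0"
    and Q: "ideal Q ring_of_type_algebra" and sub: "P \<subset> Q"
  shows "Q = UNIV"
proof -
  have iP: "ideal P ring_of_type_algebra" and prime: "\<And>x y. x * y \<in> P \<Longrightarrow> x \<in> P \<or> y \<in> P"
    using P by (auto simp: primeideal_ring_of_type_algebra_iff)
  obtain g where g: "g \<in> P" "g \<noteq> 0" "\<And>f. f \<in> P \<Longrightarrow> g dvd f"
    using poly_ideal_generator[OF iP ne] by blast
  obtain h where h: "h \<in> Q" "\<And>f. f \<in> Q \<Longrightarrow> h dvd f"
    using poly_ideal_generator[OF Q] ne sub by blast
  obtain k where k: "g = h * k" using h(2) g(1) sub by blast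
  have "h \<notin> P"
  proof
    assume "h \<in> P"
    then have "Q \<subseteq> P" using h(2) ideal_mult_right[OF iP] by (auto elim!: dvdE)
    then show False using sub by blast
  qed
  then have "k \<in> P" using prime g(1) k by blast
  then obtain l where "k = g * l" using g(3) by blast
  then have "g * (h * l) = g * 1" using k by (simp add: mult_ac)
  then have "h * l = 1" using g(2) unfolding mult_cancel_left by blast
  then have "1 \<in> Q" using ideal_mult_right[OF Q h(1), of l] by simp
  then show ?thesis by (rule ideal_eq_UNIV[OF Q])
qed

text \<open>With \<open>\<alpha>\<^sub>i \<noteq> 0\<close>, the linear form \<open>t\<^sub>i / \<alpha>\<^sub>i\<close> restricts to \<open>x\<close>. Together with the next three
lemmas this identifies the ideals containing \<open>line_ideal \<alpha>\<close> with ideals of \<open>K[x]\<close>.\<close>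

lemma line_restriction_surj:
  assumes "\<alpha> \<noteq> 0"
  shows "surj (line_restriction \<alpha>)"
proof -
  from assms obtain i where i: "\<alpha> $ i \<noteq> 0" by (auto simp: vec_eq_iff)
  have "\<exists>f. line_restriction \<alpha> f = p" for p
  proof (induction p)
    case 0
    show ?case by (intro exI[of _ 0]) simp
  next
    case (pCons a p)
    then obtain f where "line_restriction \<alpha> f = p" by blast
    then have "line_restriction \<alpha> (const a + const (inverse (\<alpha> $ i)) * var i * f) = pCons a p"
      using i by (simp add: line_restriction_var monom_altdef)
    then show ?case by blast
  qed
  then show ?thesis by (metis surjI)
qed

lemma line_restriction_mem_image_iff:
  assumes "ideal P ring_of_type_algebra" "line_ideal \<alpha> \<subseteq> P"
  shows "line_restriction \<alpha> f \<in> line_restriction \<alpha> ` P \<longleftrightarrow> f \<in> P"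
proof
  assume "line_restriction \<alpha> f \<in> line_restriction \<alpha> ` P"
  then obtain g where g: "g \<in> P" "line_restriction \<alpha> f = line_restriction \<alpha> g" by blast
  then have "f - g \<in> P" using assms(2) by (auto simp: line_ideal_def)
  then have "f - g + g \<in> P" using g(1) by (rule ideal_add[OF assms(1)])
  then show "f \<in> P" by simp
qed simp

lemma ideal_line_restriction_image:
  assumes "ideal P ring_of_type_algebra" "\<alpha> \<noteq> 0"
  shows "ideal (line_restriction \<alpha> ` P) ring_of_type_algebra"
  unfolding ideal_ring_of_type_algebra_iff
proof (intro conjI ballI allI)
  show "0 \<in> line_restriction \<alpha> ` P"
    using ideal_zero[OF assms(1)] by (metis imageI line_restriction_zero)
  show "x + y \<in> line_restriction \<alpha> ` P" if "x \<in> line_restriction \<alpha> ` P" "y \<in> line_restriction \<alpha> ` P" for x y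
    using that ideal_add[OF assms(1)] by (auto simp flip: line_restriction_add)
  show "y * x \<in> line_restriction \<alpha> ` P" if x: "x \<in> line_restriction \<alpha> ` P" for x y
  proof -
    obtain g where "y = line_restriction \<alpha> g"
      using surjD[OF line_restriction_surj[OF assms(2)]] by blast
    moreover obtain f where "f \<in> P" "x = line_restriction \<alpha> f" using x by blast
    ultimately show ?thesis using ideal_mult[OF assms(1), of f g] by (simp flip: line_restriction_mult)
  qed
qed

lemma primeideal_line_restriction_image:
  assumes P: "primeideal P ring_of_type_algebra" and "\<alpha> \<noteq> 0" "line_ideal \<alpha> \<subseteq> P"
  shows "primeideal (line_restriction \<alpha> ` P) ring_of_type_algebra"
proof -
  have iP: "ideal P ring_of_type_algebra" "P \<noteq> UNIV" and prime: "\<And>x y. x * y \<in> P \<Longrightarrow> x \<in> P \<or> y \<in> P"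
    using P by (auto simp: primeideal_ring_of_type_algebra_iff)
  note iff = line_restriction_mem_image_iff[OF iP(1) assms(3)]
  show ?thesis
    unfolding primeideal_ring_of_type_algebra_iff
  proof (intro conjI allI impI)
    show "ideal (line_restriction \<alpha> ` P) ring_of_type_algebra"
      by (rule ideal_line_restriction_image[OF iP(1) assms(2)])
    show "line_restriction \<alpha> ` P \<noteq> UNIV" using iff iP(2) by blast
    fix x y assume xy: "x * y \<in> line_restriction \<alpha> ` P"
    obtain f where f: "x = line_restriction \<alpha> f"
      using surjD[OF line_restriction_surj[OF assms(2)]] by blast
    obtain g where g: "y = line_restriction \<alpha> g"
      using surjD[OF line_restriction_surj[OF assms(2)]] by blast
    note fg = f g
    with xy have "f * g \<in> P" using iff by (simp flip: line_restriction_mult)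
    then show "x \<in> line_restriction \<alpha> ` P \<or> y \<in> line_restriction \<alpha> ` P"
      using prime fg iff by blast
  qed
qed

text \<open>Above \<open>J\<close> there is the chain consisting of the ideal of the point \<open>[\<alpha>]\<close> and the ideal generated by
the variables. A longer chain is impossible: its lowest member contains the intersection of the
ideals of the points of \<open>A\<close>, hence one of them, and then the restriction to the corresponding line
maps the next two members to a nonzero prime ideal of \<open>K[x]\<close> and a proper ideal above it.\<close>

lemma krull_dim_points:
  fixes J :: "('n::finite, 'k::field) mvpoly set"
  assumes J: "ideal J ring_of_type_algebra" and A: "finite A" "0 \<notin> A" "(\<Inter>\<alpha>\<in>A. line_ideal \<alpha>) \<subseteq> J"
    and \<alpha>: "\<alpha> \<noteq> 0" "J \<subseteq> line_ideal \<alpha>"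
  shows "krull_dim (mvpoly_ring Quot J) = 1"
proof -
  interpret cring "mvpoly_ring :: ('n, 'k) mvpoly ring" by (rule cring_from_type_algebra)
  let ?S = "{enat n | n. \<exists>P. (\<forall>i\<le>n. primeideal (P i) mvpoly_ring \<and> J \<subseteq> P i) \<and> (\<forall>i<n. P i \<subset> P (Suc i))}"
  have "Sup ?S = 1"
  proof (rule antisym)
    \<comment> \<open>The polynomials without constant term.\<close>
    let ?M = "{f. Polynomial.coeff (line_restriction \<alpha> f) 0 = 0}"
    have M: "primeideal ?M mvpoly_ring"
    proof -
      have "1 \<notin> ?M" by simp
      then have "?M \<noteq> UNIV" by blast
      then show ?thesis
        by (simp add: primeideal_ring_of_type_algebra_iff ideal_ring_of_type_algebra_iff coeff_mult_0)
    qed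
    have "line_ideal \<alpha> \<subset> ?M"
    proof
      show "line_ideal \<alpha> \<subseteq> ?M" by (auto simp: line_ideal_def)
      from \<alpha>(1) obtain i where "\<alpha> $ i \<noteq> 0" by (auto simp: vec_eq_iff)
      then have "var i \<in> ?M" "var i \<notin> line_ideal \<alpha>"
        by (auto simp: line_ideal_def line_restriction_var monom_eq_0_iff)
      then show "line_ideal \<alpha> \<noteq> ?M" by blast
    qed
    then have "enat 1 \<in> ?S"
      using M primeideal_line_ideal[of \<alpha>] \<alpha>(2)
      by (intro CollectI exI[of _ 1] conjI exI[of _ "\<lambda>i. if i = 0 then line_ideal \<alpha> else ?M"]) auto
    then have "enat 1 \<le> Sup ?S" by (rule Sup_upper)
    then show "1 \<le> Sup ?S" by (simp only: one_enat_def)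
  next
    show "Sup ?S \<le> 1"
    proof (rule Sup_least, clarify)
      fix n P assume P: "\<forall>i\<le>n. primeideal (P i) mvpoly_ring \<and> J \<subseteq> P i" "\<forall>i<n. P i \<subset> P (Suc i)"
      have False if n: "2 \<le> n"
      proof -
        have P0: "primeideal (P 0) mvpoly_ring" "J \<subseteq> P 0" and P1: "primeideal (P 1) mvpoly_ring"
          and P2: "primeideal (P 2) mvpoly_ring"
          using P(1) n by auto
        have P01: "P 0 \<subset> P 1" and P12: "P 1 \<subset> P 2"
          using P(2) n by (auto simp: numeral_2_eq_2)
        obtain \<beta> where \<beta>: "\<beta> \<in> A" "line_ideal \<beta> \<subseteq> P 0"
          using primeideal_INT_subset[OF P0(1) A(1) ideal_line_ideal subset_trans[OF A(3) P0(2)]] by blast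
        have \<beta>0: "\<beta> \<noteq> 0" using \<beta>(1) A(2) by blast
        have i2: "ideal (P 2) mvpoly_ring" "P 2 \<noteq> UNIV" and i1: "ideal (P 1) mvpoly_ring"
          using P1 P2 by (simp_all add: primeideal_ring_of_type_algebra_iff)
        have sub1: "line_ideal \<beta> \<subseteq> P 1" and sub2: "line_ideal \<beta> \<subseteq> P 2"
          using \<beta>(2) P01 P12 by auto
        have "\<exists>f\<in>line_restriction \<beta> ` P 1. f \<noteq> 0"
          using P01 \<beta>(2) by (auto simp: line_ideal_def)
        moreover have "line_restriction \<beta> ` P 1 \<subset> line_restriction \<beta> ` P 2"
          using P12 line_restriction_mem_image_iff[OF i1 sub1] by blast
        ultimately have "line_restriction \<beta> ` P 2 = UNIV"
          by (rule nonzero_primeideal_poly_maximal[OF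
                primeideal_line_restriction_image[OF P1 \<beta>0 sub1] _
                ideal_line_restriction_image[OF i2(1) \<beta>0]])
        then have "f \<in> P 2" for f
          using line_restriction_mem_image_iff[OF i2(1) sub2, of f] by simp
        then show False using i2(2) by blast
      qed
      then have "n \<le> 1" by force
      then show "enat n \<le> 1" by (simp add: one_enat_def)
    qed
  qed
  then show ?thesis by (simp only: krull_dim_quot[OF J])
qed

section \<open>The degree and the colon ideal\<close>

text \<open>The Krull dimension is 1, so the degree is the limit of the Hilbert function itself, which is
eventually constant.\<close>

lemma quot_degree_points:
  fixes A :: "('k::field ^ 'n::finite) set" and F :: "('n, 'k) mvpoly set"
  assumes A: "finite A" "projectively_distinct A"
    and F: "finite F" "\<And>f. f \<in> F \<Longrightarrow> homogeneous f"
    and ne: "{\<alpha>\<in>A. \<forall>f\<in>F. eval f \<alpha> = 0} \<noteq> {}"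
  shows "quot_degree (Idl\<^bsub>mvpoly_ring\<^esub> ((\<Inter>\<alpha>\<in>A. line_ideal \<alpha>) \<union> F)) =
    real (card {\<alpha>\<in>A. \<forall>f\<in>F. eval f \<alpha> = 0})"
proof -
  let ?V = "{\<alpha>\<in>A. \<forall>f\<in>F. eval f \<alpha> = 0}"
  let ?J = "Idl\<^bsub>mvpoly_ring\<^esub> ((\<Inter>\<alpha>\<in>A. line_ideal \<alpha>) \<union> F)"
  from ne obtain \<alpha> where \<alpha>: "\<alpha> \<in> A" "\<forall>f\<in>F. eval f \<alpha> = 0" by blast
  have "?J \<subseteq> line_ideal \<alpha>"
    by (rule genideal_subset[OF ideal_line_ideal])
      (use \<alpha> F(2) homogeneous_in_line_ideal_iff in auto)
  moreover have "(\<Inter>\<alpha>\<in>A. line_ideal \<alpha>) \<subseteq> ?J"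
    using genideal_superset[of "(\<Inter>\<alpha>\<in>A. line_ideal \<alpha>) \<union> F"] by blast
  ultimately have dim: "krull_dim (mvpoly_ring Quot ?J) = 1"
    using A \<alpha>(1) by (intro krull_dim_points[of _ A \<alpha>] ideal_genideal) (auto simp: projectively_distinct_def)
  obtain N where N: "\<And>d. d \<ge> N \<Longrightarrow> ?J \<inter> graded_part d = (\<Inter>\<alpha>\<in>?V. line_ideal \<alpha>) \<inter> graded_part d"
    using genideal_points_eventually_eq[OF A F] by blast
  have V: "finite ?V" "projectively_distinct ?V"
    using A by (auto intro: projectively_distinct_subset)
  have "hilbert_fun ?J d = card ?V" if "d \<ge> max N (card ?V)" for d
  proof -
    have "hilbert_fun ?J d = hilbert_fun (\<Inter>\<alpha>\<in>?V. line_ideal \<alpha>) d"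
      unfolding hilbert_fun_def using N[of d] that by simp
    also have "\<dots> = card ?V" using hilbert_fun_points[OF V] that by simp
    finally show ?thesis .
  qed
  then have "eventually (\<lambda>d. real (hilbert_fun ?J d) / real d ^ (1 - 1) = real (card ?V)) sequentially"
    unfolding eventually_sequentially by (intro exI[of _ "max N (card ?V)"]) simp
  then have "(\<lambda>d. real (hilbert_fun ?J d) / real d ^ (1 - 1)) \<longlonglongrightarrow> real (card ?V)"
    by (rule tendsto_eventually)
  then have "lim (\<lambda>d. real (hilbert_fun ?J d) / real d ^ (1 - 1)) = real (card ?V)"
    by (rule limI)
  then show ?thesis
    unfolding quot_degree_def dim by (simp add: one_enat_def)
qed

text \<open>At a common zero \<open>\<alpha>\<close> of \<open>F\<close>, the dual form of \<open>\<alpha>\<close> multiplies \<open>F\<close> into the ideal of \<open>A\<close>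
without belonging to it. Conversely, if every point of \<open>A\<close> has an \<open>f \<in> F\<close> outside its prime
ideal, then \<open>g f\<close> in the ideal of the point forces \<open>g\<close> into it.\<close>

lemma colon_points_eq_iff:
  fixes A :: "('k::field ^ 'n::finite) set" and F :: "('n, 'k) mvpoly set"
  assumes A: "finite A" "projectively_distinct A" and F: "\<And>f. f \<in> F \<Longrightarrow> homogeneous f"
  shows "colon (\<Inter>\<alpha>\<in>A. line_ideal \<alpha>) F = (\<Inter>\<alpha>\<in>A. line_ideal \<alpha>) \<longleftrightarrow>
    {\<alpha>\<in>A. \<forall>f\<in>F. eval f \<alpha> = 0} = {}"
proof -
  let ?I = "\<Inter>\<alpha>\<in>A. line_ideal \<alpha>"
  let ?V = "{\<alpha>\<in>A. \<forall>f\<in>F. eval f \<alpha> = 0}"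
  show ?thesis
  proof
    assume eq: "colon ?I F = ?I"
    show "?V = {}"
    proof (rule ccontr)
      assume "?V \<noteq> {}"
      then obtain \<alpha> where \<alpha>: "\<alpha> \<in> A" "\<forall>f\<in>F. eval f \<alpha> = 0" by blast
      obtain e where e: "e \<in> graded_part (card A)"
        "\<And>\<beta>. \<beta> \<in> A \<Longrightarrow> eval e \<beta> = (if \<beta> = \<alpha> then 1 else 0)"
        using exists_dual_forms[OF A order_refl] \<alpha>(1) by metis
      have "homogeneous e" using e(1) by (auto simp: homogeneous_def)
      then have e_mem: "e \<in> line_ideal \<beta> \<longleftrightarrow> \<beta> \<noteq> \<alpha>" if "\<beta> \<in> A" for \<beta>
        using e(2)[OF that] by (simp add: homogeneous_in_line_ideal_iff)
      have "e * f \<in> line_ideal \<beta>" if "f \<in> F" "\<beta> \<in> A" for f \<beta>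
      proof (cases "\<beta> = \<alpha>")
        case True
        then show ?thesis
          using that \<alpha>(2) F by (intro ideal_mult[OF ideal_line_ideal]) (simp add: homogeneous_in_line_ideal_iff)
      next
        case False
        then show ?thesis using e_mem that by (intro ideal_mult_right[OF ideal_line_ideal]) simp
      qed
      then have "e \<in> colon ?I F" by (simp add: colon_def)
      with eq have "e \<in> line_ideal \<alpha>" using \<alpha>(1) by blast
      then show False using e_mem[OF \<alpha>(1)] by simp
    qed
  next
    assume V: "?V = {}"
    show "colon ?I F = ?I"
    proof
      show "?I \<subseteq> colon ?I F"
        unfolding colon_def using ideal_mult_right[OF ideal_INT_line_ideal] by blast
      show "colon ?I F \<subseteq> ?I"
      proof (rule subsetI, rule INT_I)
        fix g \<alpha> assume g: "g \<in> colon ?I F" and \<alpha>: "\<alpha> \<in> A"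
        from V \<alpha> obtain f where f: "f \<in> F" "eval f \<alpha> \<noteq> 0" by blast
        from g f(1) \<alpha> have "g * f \<in> line_ideal \<alpha>" unfolding colon_def by blast
        moreover have "f \<notin> line_ideal \<alpha>" using f F by (simp add: homogeneous_in_line_ideal_iff)
        ultimately show "g \<in> line_ideal \<alpha>"
          using primeideal_line_ideal by (auto simp: primeideal_ring_of_type_algebra_iff)
      qed
    qed
  qed
qed

theorem lemma3p4:
  fixes \<X> :: "('k::field ^ 'n::finite) set set"
    and F :: "('n, 'k) mvpoly set"
  assumes "\<X> \<subseteq> proj_space" and "finite \<X>"
    and "finite F" and "F \<noteq> {}"
    and "\<And>f. f \<in> F \<Longrightarrow> homogeneous f \<and> f \<noteq> 0"
  shows "real (card (zero_locus \<X> F)) =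
    (if colon (vanishing_ideal \<X>) F \<noteq> vanishing_ideal \<X>
     then quot_degree (Idl\<^bsub>mvpoly_ring\<^esub> (vanishing_ideal \<X> \<union> F))
     else 0)"
proof -
  let ?A = "proj_rep ` \<X>"
  let ?V = "{\<alpha>\<in>?A. \<forall>f\<in>F. eval f \<alpha> = 0}"
  have A: "finite ?A" "projectively_distinct ?A"
  proof -
    show "finite ?A" using assms(2) by simp
    have "0 \<notin> ?A" using assms(1) proj_rep_nonzero by (metis imageE subsetD)
    moreover have "proj_rep p = proj_rep q"
      if "p \<in> \<X>" "q \<in> \<X>" "(proj_rep p, proj_rep q) \<in> proportional" for p q
      using proj_rep_proportional_imp_eq[of p q] that assms(1) by blast
    ultimately show "projectively_distinct ?A"
      unfolding projectively_distinct_def by (simp add: ball_simps)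
  qed
  have F: "\<And>f. f \<in> F \<Longrightarrow> homogeneous f" using assms(5) by simp
  have "inj_on proj_rep \<X>"
  proof (rule inj_onI)
    fix p q assume pq: "p \<in> \<X>" "q \<in> \<X>" "proj_rep p = proj_rep q"
    then have "p \<in> proj_space" "q \<in> proj_space" using assms(1) by auto
    moreover have "(proj_rep p, proj_rep q) \<in> proportional"
      using pq(3) equivE[OF equiv_proportional] proj_rep_nonzero[OF \<open>p \<in> proj_space\<close>]
      by (metis Diff_iff UNIV_I refl_onD singletonD)
    ultimately show "p = q" by (rule proj_rep_proportional_imp_eq)
  qed
  moreover have "?V = proj_rep ` zero_locus \<X> F"
    unfolding zero_locus_def using assms(1) F by (auto simp: vanishes_at_iff subset_iff)
  moreover have "zero_locus \<X> F \<subseteq> \<X>" by (auto simp: zero_locus_def)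
  ultimately have card_V: "card (zero_locus \<X> F) = card ?V"
    by (metis card_image inj_on_subset)
  show ?thesis
  proof (cases "?V = {}")
    case True
    then have "colon (vanishing_ideal \<X>) F = vanishing_ideal \<X>"
      using colon_points_eq_iff[OF A F] vanishing_ideal_eq[OF assms(1)] by simp
    with True show ?thesis by (simp only: card_V) simp
  next
    case False
    then have "colon (vanishing_ideal \<X>) F \<noteq> vanishing_ideal \<X>"
      using colon_points_eq_iff[OF A F] vanishing_ideal_eq[OF assms(1)] by simp
    moreover have "quot_degree (Idl\<^bsub>mvpoly_ring\<^esub> (vanishing_ideal \<X> \<union> F)) = real (card ?V)"
      unfolding vanishing_ideal_eq[OF assms(1)] by (rule quot_degree_points[OF A assms(3) F False])
    ultimately show ?thesis by (simp only: card_V) simp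
  qed
qed

end
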